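(* There is a total computable function $d:\mathbb{N}\to\mathbb{N}$ such that for every index $a\in\mathbb{N}$, writing $\delta_a:=d(a)$: (1) $\delta_a\in\mathbf{M} \iff \varphi_a(\delta_a)\!\downarrow=1$; (2) exactly one of the following holds: (i) $\varphi_a(\delta_a)\!\downarrow=1$; (ii) $\varphi_a(\delta_a)\!\downarrow\neq 1$; (iii) $\varphi_a(\delta_a)\!\uparrow$. Consequently no adjudicator over the standard domain is simultaneously total (T), exhaustive (E), and sound (S): case (i) refutes (S), case (ii) refutes (E), and case (iii) refutes (T).
   Context: $(\varphi_e)_{e\in\mathbb{N}}$ is a fixed standard acceptable numbering of the unary partial computable functions. $\varphi_a(x)\!\downarrow=1$ means the computation converges with value $1$; $\varphi_a(x)\!\downarrow\neq1$ means it converges with a value other than $1$; $\varphi_a(x)\!\uparrow$ means it diverges. The manifestation set is $\mathbf{M}=\{p\in\mathbb{N}:\varphi_p(0)\!\downarrow=1\}$. The standard domain is $(\mathbb{N},\mathbf{M})$. An adjudicator is an index $a$, acting through $\varphi_a$: it annuls $p$ if $\varphi_a(p)\!\downarrow=1$, exempts $p$ if $\varphi_a(p)\!\downarrow\neq1$, and is silent on $p$ if $\varphi_a(p)\!\uparrow$. Over the standard domain, $a$ is: (T) total if it is silent on no $p\in\mathbb{N}$; (E) exhaustive if it annuls every $p\in\mathbb{N}$; (S) sound if for all $p$, $\varphi_a(p)\!\downarrow=1$ implies $p\notin\mathbf{M}$. *)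

theory Defs
  imports Main
begin

text \<open>
  Partial functions are option-valued, with \<open>None\<close> for divergence. An \<open>n\<close>-ary function takes its
  arguments as a list; only its values on lists of length \<open>n\<close> are meaningful.
\<close>

text \<open>
  Unbounded search is strict: the search diverges if some value before the first zero is undefined.
\<close>

definition minimize :: "(nat \<Rightarrow> nat option) \<Rightarrow> nat option" where
  "minimize f =
     (if \<exists>z. f z = Some 0 \<and> (\<forall>y<z. f y \<noteq> None) then Some (LEAST z. f z = Some 0) else None)"

text \<open>
  Kleene's class of partial recursive functions. Composition is strict, because \<open>those\<close> returns
  \<open>None\<close> as soon as one inner function diverges. Recursion and search run over the first argument;
  a step function of a recursion receives the counter, the previous value and the parameters.
\<close>

inductive partial_recursive :: "nat \<Rightarrow> (nat list \<Rightarrow> nat option) \<Rightarrow> bool" where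
  zero: "partial_recursive n (\<lambda>xs. Some 0)"
| succ: "partial_recursive 1 (\<lambda>xs. Some (Suc (hd xs)))"
| proj: "i < n \<Longrightarrow> partial_recursive n (\<lambda>xs. Some (xs ! i))"
| comp: "partial_recursive (length gs) f \<Longrightarrow> (\<forall>g\<in>set gs. partial_recursive n g) \<Longrightarrow>
    partial_recursive n (\<lambda>xs. Option.bind (those (map (\<lambda>g. g xs) gs)) f)"
| prim_rec: "partial_recursive n f \<Longrightarrow> partial_recursive (Suc (Suc n)) g \<Longrightarrow>
    partial_recursive (Suc n)
      (\<lambda>xs. rec_nat (f (tl xs)) (\<lambda>k r. Option.bind r (\<lambda>v. g (k # v # tl xs))) (hd xs))"
| search: "partial_recursive (Suc n) f \<Longrightarrow>
    partial_recursive n (\<lambda>xs. minimize (\<lambda>z. f (z # xs)))"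

definition partial_computable :: "(nat \<Rightarrow> nat option) \<Rightarrow> bool" where
  "partial_computable \<psi> \<longleftrightarrow> (\<exists>F. partial_recursive 1 F \<and> (\<forall>x. \<psi> x = F [x]))"

definition partial_computable2 :: "(nat \<Rightarrow> nat \<Rightarrow> nat option) \<Rightarrow> bool" where
  "partial_computable2 \<psi> \<longleftrightarrow> (\<exists>F. partial_recursive 2 F \<and> (\<forall>x y. \<psi> x y = F [x, y]))"

definition total_computable :: "(nat \<Rightarrow> nat) \<Rightarrow> bool" where
  "total_computable f \<longleftrightarrow> partial_computable (\<lambda>x. Some (f x))"

text \<open>
  Acceptable numberings in the sense of Rogers: the universal function is partial computable, and
  every partial computable binary function can be effectively curried (the s-m-n property).
\<close>

definition acceptable_numbering :: "(nat \<Rightarrow> nat \<Rightarrow> nat option) \<Rightarrow> bool" where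
  "acceptable_numbering \<phi> \<longleftrightarrow>
     range \<phi> = {\<psi>. partial_computable \<psi>} \<and>
     partial_computable2 \<phi> \<and>
     (\<forall>\<psi>. partial_computable2 \<psi> \<longrightarrow> (\<exists>s. total_computable s \<and> (\<forall>x. \<phi> (s x) = \<psi> x)))"

definition manifestation_set :: "(nat \<Rightarrow> nat \<Rightarrow> nat option) \<Rightarrow> nat set" where
  "manifestation_set \<phi> = {p. \<phi> p 0 = Some 1}"

definition annuls :: "(nat \<Rightarrow> nat \<Rightarrow> nat option) \<Rightarrow> nat \<Rightarrow> nat \<Rightarrow> bool" where
  "annuls \<phi> a p \<longleftrightarrow> \<phi> a p = Some 1"

definition silent :: "(nat \<Rightarrow> nat \<Rightarrow> nat option) \<Rightarrow> nat \<Rightarrow> nat \<Rightarrow> bool" where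
  "silent \<phi> a p \<longleftrightarrow> \<phi> a p = None"

definition total_adjudicator :: "(nat \<Rightarrow> nat \<Rightarrow> nat option) \<Rightarrow> nat \<Rightarrow> bool" where
  "total_adjudicator \<phi> a \<longleftrightarrow> (\<forall>p. \<not> silent \<phi> a p)"

definition exhaustive_adjudicator :: "(nat \<Rightarrow> nat \<Rightarrow> nat option) \<Rightarrow> nat \<Rightarrow> bool" where
  "exhaustive_adjudicator \<phi> a \<longleftrightarrow> (\<forall>p. annuls \<phi> a p)"

definition sound_adjudicator :: "(nat \<Rightarrow> nat \<Rightarrow> nat option) \<Rightarrow> nat \<Rightarrow> bool" where
  "sound_adjudicator \<phi> a \<longleftrightarrow> (\<forall>p. \<phi> a p = Some 1 \<longrightarrow> p \<notin> manifestation_set \<phi>)"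

definition exactly_one :: "bool \<Rightarrow> bool \<Rightarrow> bool \<Rightarrow> bool" where
  "exactly_one A B C \<longleftrightarrow>
     (A \<and> \<not> B \<and> \<not> C) \<or> (\<not> A \<and> B \<and> \<not> C) \<or> (\<not> A \<and> \<not> B \<and> C)"

end

theory Submission
  imports Defs
begin

text \<open>
  The function \<open>d\<close> is the parametrised fixed point \<open>\<phi>\<^bsub>d(a)\<^esub>(x) = \<phi>\<^bsub>a\<^esub>(d(a))\<close>. Pairing is avoided by
  letting an index \<open>w\<close> stand for the pair of \<open>\<phi>\<^bsub>w\<^esub>(0)\<close> and \<open>\<phi>\<^bsub>w\<^esub>(1)\<close>. Currying gives a total
  computable \<open>s\<close> such that \<open>\<phi>\<^bsub>s(w)\<^esub>(x) = \<phi>\<^bsub>i\<^esub>(\<phi>\<^bsub>j\<^esub>(w))\<close> whenever \<open>w\<close> codes \<open>(i, j)\<close>. If \<open>b\<close> is an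
  index of \<open>s\<close> itself and \<open>p(a)\<close> codes \<open>(a, b)\<close>, then \<open>d(a) = s(p(a))\<close> works, because
  \<open>\<phi>\<^bsub>b\<^esub>(p(a)) = s(p(a))\<close>.
\<close>

lemma partial_recursive_comp1:
  assumes "partial_recursive 1 F" "partial_recursive n g"
  shows "partial_recursive n (\<lambda>xs. Option.bind (g xs) (\<lambda>u. F [u]))"
proof -
  have "partial_recursive n (\<lambda>xs. Option.bind (those (map (\<lambda>g. g xs) [g])) F)"
    by (rule partial_recursive.comp) (use assms in simp_all)
  also have "(\<lambda>xs. Option.bind (those (map (\<lambda>g. g xs) [g])) F)
      = (\<lambda>xs. Option.bind (g xs) (\<lambda>u. F [u]))"
    by (auto simp: fun_eq_iff split: option.split)
  finally show ?thesis .
qed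

lemma partial_recursive_comp2:
  assumes "partial_recursive 2 F" "partial_recursive n g" "partial_recursive n h"
  shows "partial_recursive n (\<lambda>xs. Option.bind (g xs) (\<lambda>u. Option.bind (h xs) (\<lambda>v. F [u, v])))"
proof -
  have "partial_recursive n (\<lambda>xs. Option.bind (those (map (\<lambda>g. g xs) [g, h])) F)"
    by (rule partial_recursive.comp) (use assms in \<open>simp_all add: numeral_2_eq_2\<close>)
  also have "(\<lambda>xs. Option.bind (those (map (\<lambda>g. g xs) [g, h])) F)
      = (\<lambda>xs. Option.bind (g xs) (\<lambda>u. Option.bind (h xs) (\<lambda>v. F [u, v])))"
    by (auto simp: fun_eq_iff split: option.split)
  finally show ?thesis .
qed

lemma partial_recursive_const: "partial_recursive n (\<lambda>xs. Some c)"
proof (induction c)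
  case 0
  show ?case by (rule partial_recursive.zero)
next
  case (Suc c)
  from partial_recursive_comp1[OF partial_recursive.succ Suc] show ?case by simp
qed

lemma total_computable_comp:
  assumes "total_computable f" "total_computable g"
  shows "total_computable (\<lambda>x. f (g x))"
proof -
  obtain F G where F: "partial_recursive 1 F" "\<And>x. Some (f x) = F [x]"
    and G: "partial_recursive 1 G" "\<And>x. Some (g x) = G [x]"
    using assms unfolding total_computable_def partial_computable_def by blast
  show ?thesis
    unfolding total_computable_def partial_computable_def
    by (intro exI conjI, rule partial_recursive_comp1[OF F(1) G(1)])
      (simp flip: F(2) G(2))
qed

text \<open>Currying this function in \<open>a\<close> yields the code of the pair
  \<open>(a, b)\<close>: the index of a function with value \<open>a\<close> at 0 and
  \<open>b\<close> at 1.\<close>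

lemma partial_computable2_case_zero:
  "partial_computable2 (\<lambda>a x. Some (if x = 0 then a else b))"
proof -
  \<comment> \<open>Recursion runs over the first argument, so \<open>R\<close> takes
    \<open>x\<close> before \<open>a\<close>; the projections further down swap them back.\<close>
  define R where "R = (\<lambda>xs. rec_nat (Some (tl xs ! 0))
    (\<lambda>k r. Option.bind r (\<lambda>v. Some b)) (hd xs))"
  have "partial_recursive (Suc 1) R"
    unfolding R_def
    by (rule partial_recursive.prim_rec) (auto intro: partial_recursive.proj partial_recursive_const)
  then have R: "partial_recursive 2 R"
    by (simp add: numeral_2_eq_2)
  have R_eq: "R [x, a] = Some (if x = 0 then a else b)" for x a
  proof (cases x)
    case (Suc m)
    \<comment> \<open>Induction is needed because each strict step returns \<open>b\<close> only if
      the previous value is defined.\<close>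
    have "R [Suc m, a] = Some b"
      by (induction m) (simp_all add: R_def)
    with Suc show ?thesis by simp
  qed (simp add: R_def)
  have "partial_recursive 2 (\<lambda>xs. Option.bind (Some (xs ! 1))
      (\<lambda>u. Option.bind (Some (xs ! 0)) (\<lambda>v. R [u, v])))"
    by (rule partial_recursive_comp2[OF R]) (auto intro: partial_recursive.proj)
  then show ?thesis
    unfolding partial_computable2_def by (intro exI conjI, assumption) (simp add: R_eq)
qed

text \<open>Decoding \<open>w\<close> takes two runs of the universal function, at the constants 0
  and 1; applying \<open>j\<close> and then \<open>i\<close> takes two more.\<close>

lemma partial_computable2_apply_coded:
  assumes "partial_computable2 \<phi>"
  shows "partial_computable2 (\<lambda>w x. Option.bind (\<phi> w 0)
    (\<lambda>i. Option.bind (Option.bind (\<phi> w 1) (\<lambda>j. \<phi> j w)) (\<phi> i)))"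
proof -
  obtain U where U: "partial_recursive 2 U" "\<And>x y. \<phi> x y = U [x, y]"
    using assms unfolding partial_computable2_def by blast
  have w: "partial_recursive 2 (\<lambda>xs. Some (xs ! 0))"
    by (rule partial_recursive.proj) simp
  note at = partial_recursive_comp2[OF U(1) w partial_recursive_const]
  from partial_recursive_comp2[OF U(1) at[of 0] partial_recursive_comp2[OF U(1) at[of 1] w]]
  show ?thesis
    unfolding partial_computable2_def by (intro exI conjI, assumption) (simp flip: U(2))
qed

lemma acceptable_numbering_index:
  assumes "acceptable_numbering \<phi>" "total_computable f"
  obtains b where "\<And>x. \<phi> b x = Some (f x)"
proof -
  have "(\<lambda>x. Some (f x)) \<in> range \<phi>"
    using assms unfolding acceptable_numbering_def total_computable_def by simp
  then obtain b where "(\<lambda>x. Some (f x)) = \<phi> b"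
    by blast
  then show thesis
    by (metis that)
qed

lemma acceptable_numbering_curry:
  assumes "acceptable_numbering \<phi>" "partial_computable2 \<psi>"
  obtains s where "total_computable s" "\<And>x. \<phi> (s x) = \<psi> x"
  using assms unfolding acceptable_numbering_def by blast

lemma diagonal_index_function:
  assumes "acceptable_numbering \<phi>"
  obtains d where "total_computable d" "\<And>a x. \<phi> (d a) x = \<phi> a (d a)"
proof -
  have "partial_computable2 \<phi>"
    using assms unfolding acceptable_numbering_def by simp
  then obtain s where s: "total_computable s"
    and \<phi>_s: "\<And>w. \<phi> (s w) = (\<lambda>x. Option.bind (\<phi> w 0)
      (\<lambda>i. Option.bind (Option.bind (\<phi> w 1) (\<lambda>j. \<phi> j w)) (\<phi> i)))"
    using acceptable_numbering_curry[OF assms partial_computable2_apply_coded] by metis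
  \<comment> \<open>The self-reference: \<open>b\<close> depends on \<open>s\<close> alone, so it is
    a constant when \<open>p\<close> is built uniformly in \<open>a\<close>.\<close>
  obtain b where b: "\<And>w. \<phi> b w = Some (s w)"
    using acceptable_numbering_index[OF assms s] by blast
  obtain p where p: "total_computable p"
    and \<phi>_p: "\<And>a. \<phi> (p a) = (\<lambda>x. Some (if x = 0 then a else b))"
    using acceptable_numbering_curry[OF assms partial_computable2_case_zero[of b]] by metis
  show thesis
  proof (rule that[of "\<lambda>a. s (p a)"])
    show "total_computable (\<lambda>a. s (p a))"
      by (rule total_computable_comp[OF s p])
    \<comment> \<open>Decoding \<open>p a\<close> gives \<open>i = a\<close> and
      \<open>j = b\<close>, and running \<open>b\<close> on \<open>p a\<close> returns
      \<open>s (p a)\<close>.\<close>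
    show "\<phi> (s (p a)) x = \<phi> a (s (p a))" for a x
      using \<phi>_s[of "p a"] by (simp add: \<phi>_p b)
  qed
qed

theorem theorem3p1:
  fixes \<phi> :: "nat \<Rightarrow> nat \<Rightarrow> nat option"
  assumes "acceptable_numbering \<phi>"
  shows "(\<exists>d :: nat \<Rightarrow> nat. total_computable d \<and>
           (\<forall>a.
             (d a \<in> manifestation_set \<phi> \<longleftrightarrow> \<phi> a (d a) = Some 1) \<and>
             exactly_one
               (\<phi> a (d a) = Some 1)
               (\<exists>v. \<phi> a (d a) = Some v \<and> v \<noteq> 1)
               (\<phi> a (d a) = None) \<and>
             (\<phi> a (d a) = Some 1 \<longrightarrow> \<not> sound_adjudicator \<phi> a) \<and>
             ((\<exists>v. \<phi> a (d a) = Some v \<and> v \<noteq> 1) \<longrightarrow> \<not> exhaustive_adjudicator \<phi> a) \<and>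
             (\<phi> a (d a) = None \<longrightarrow> \<not> total_adjudicator \<phi> a))) \<and>
         \<not> (\<exists>a. total_adjudicator \<phi> a \<and> exhaustive_adjudicator \<phi> a \<and> sound_adjudicator \<phi> a)"
proof -
  obtain d where d: "total_computable d" and fixed: "\<And>a x. \<phi> (d a) x = \<phi> a (d a)"
    using diagonal_index_function[OF assms] by blast
  \<comment> \<open>This is the fixed-point equation at \<open>x = 0\<close>.\<close>
  have M: "d a \<in> manifestation_set \<phi> \<longleftrightarrow> \<phi> a (d a) = Some 1" for a
    by (simp add: manifestation_set_def fixed)
  have trichotomy: "exactly_one (\<phi> a (d a) = Some 1)
      (\<exists>v. \<phi> a (d a) = Some v \<and> v \<noteq> 1) (\<phi> a (d a) = None)" for a
    by (cases "\<phi> a (d a)") (auto simp: exactly_one_def)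
  have unsound: "\<not> sound_adjudicator \<phi> a" if "\<phi> a (d a) = Some 1" for a
    using that M unfolding sound_adjudicator_def by blast
  have not_exhaustive: "\<not> exhaustive_adjudicator \<phi> a"
    if "\<exists>v. \<phi> a (d a) = Some v \<and> v \<noteq> 1" for a
    using that unfolding exhaustive_adjudicator_def annuls_def by force
  have not_total: "\<not> total_adjudicator \<phi> a" if "\<phi> a (d a) = None" for a
    using that unfolding total_adjudicator_def silent_def by blast
  \<comment> \<open>Exhaustiveness makes \<open>a\<close> annul \<open>d a\<close>, which refutes
    soundness.\<close>
  have "\<not> (\<exists>a. total_adjudicator \<phi> a \<and> exhaustive_adjudicator \<phi> a \<and> sound_adjudicator \<phi> a)"
    using unsound by (auto simp: exhaustive_adjudicator_def annuls_def)
  with d M trichotomy unsound not_exhaustive not_total show ?thesis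
    by blast
qed

end
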